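(* Let $0<\lambda<1$ and $\zeta_\lambda(z)=\lambda\frac{z}{z+1}e^{-z}$, $z\in\mathbb{C}$. Let $A(0)=\{z\in\hat{\mathbb{C}}:\zeta_\lambda^{n}(z)\to 0 \text{ as } n\to\infty\}$ be the basin of attraction of the attracting fixed point $0$. Then the Julia set satisfies $J(\zeta_\lambda)=\hat{\mathbb{C}}\setminus A(0)$.
   Context: $\hat{\mathbb{C}}$ is the extended complex plane. For the transcendental meromorphic function $\zeta_\lambda$, the Fatou set $F(\zeta_\lambda)$ is the set of points of $\hat{\mathbb{C}}$ having a neighbourhood on which all iterates $\zeta_\lambda^{n}$ are defined and form a normal family; the Julia set $J(\zeta_\lambda)$ is its complement $\hat{\mathbb{C}}\setminus F(\zeta_\lambda)$. *)

theory Defs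
  imports "HOL-Analysis.Analysis"
begin

text \<open>The extended complex plane is modelled as complex option:
  Some z is the finite point z, None is the point at infinity.\<close>
type_synonym ecomplex = "complex option"

fun cdist :: "ecomplex \<Rightarrow> ecomplex \<Rightarrow> real" where
  "cdist (Some z) (Some w) =
     2 * cmod (z - w) / (sqrt (1 + (cmod z)\<^sup>2) * sqrt (1 + (cmod w)\<^sup>2))"
| "cdist (Some z) None = 2 / sqrt (1 + (cmod z)\<^sup>2)"
| "cdist None (Some w) = 2 / sqrt (1 + (cmod w)\<^sup>2)"
| "cdist None None = 0"

definition eopen :: "ecomplex set \<Rightarrow> bool" where
  "eopen U \<longleftrightarrow> (\<forall>p\<in>U. \<exists>e>0. {q. cdist p q < e} \<subseteq> U)"

text \<open>The map zeta_lambda(z) = lambda z/(z+1) e^(-z) on the extended plane, as a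
  partial map: it sends the pole -1 to infinity and is undefined at infinity
  (an essential singularity).\<close>
fun zeta_step :: "real \<Rightarrow> ecomplex \<Rightarrow> ecomplex option" where
  "zeta_step lam None = None"
| "zeta_step lam (Some z) =
     (if z = -1 then Some None
      else Some (Some (complex_of_real lam * (z / (z + 1)) * exp (- z))))"

fun zeta_iter :: "real \<Rightarrow> nat \<Rightarrow> ecomplex \<Rightarrow> ecomplex option" where
  "zeta_iter lam 0 p = Some p"
| "zeta_iter lam (Suc n) p = Option.bind (zeta_iter lam n p) (zeta_step lam)"

definition loc_unif_conv ::
  "ecomplex set \<Rightarrow> (nat \<Rightarrow> ecomplex \<Rightarrow> ecomplex) \<Rightarrow> (ecomplex \<Rightarrow> ecomplex) \<Rightarrow> bool" where
  "loc_unif_conv U g h \<longleftrightarrow>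
     (\<forall>p\<in>U. \<exists>r>0. \<forall>e>0. \<exists>N. \<forall>j\<ge>N. \<forall>q\<in>U. cdist p q < r \<longrightarrow> cdist (g j q) (h q) < e)"

definition normal_family :: "ecomplex set \<Rightarrow> (nat \<Rightarrow> ecomplex \<Rightarrow> ecomplex) \<Rightarrow> bool" where
  "normal_family U F \<longleftrightarrow>
     (\<forall>s :: nat \<Rightarrow> nat. \<exists>r h. strict_mono r \<and> loc_unif_conv U (\<lambda>j. F (s (r j))) h)"

definition fatou_set :: "real \<Rightarrow> ecomplex set" where
  "fatou_set lam = {p. \<exists>U. eopen U \<and> p \<in> U \<and>
      (\<forall>n. \<forall>q\<in>U. zeta_iter lam n q \<noteq> None) \<and>
      normal_family U (\<lambda>n q. the (zeta_iter lam n q))}"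

definition julia_set :: "real \<Rightarrow> ecomplex set" where
  "julia_set lam = UNIV - fatou_set lam"

definition basin0 :: "real \<Rightarrow> ecomplex set" where
  "basin0 lam = {p. (\<forall>n. zeta_iter lam n p \<noteq> None) \<and>
      (\<lambda>n. cdist (the (zeta_iter lam n p)) (Some 0)) \<longlonglongrightarrow> 0}"

end

theory Submission
  imports Defs "HOL-Complex_Analysis.Cauchy_Integral_Formula"
begin

text \<open>
  Write \<open>\<Omega>\<close> for the plane slit along \<open>[0, \<infinity>)\<close>. The half-line is forward invariant and lies in the
  basin, so a ball whose iterates are all finite and which misses the basin is mapped into \<open>\<Omega>\<close> by
  every iterate. By the Schwarz--Pick lemma the derivatives of the iterates at its centre are then
  bounded in the hyperbolic metric of \<open>\<Omega>\<close>. On the other hand the map expands this metric, by a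
  factor bounded away from 1 off a neighbourhood of the half-line, and this neighbourhood is
  contained in the basin; so such a ball does not exist. Normality makes the basin relatively
  closed in a connected neighbourhood of a Fatou point, hence it contains the whole neighbourhood.
  The expansion is proved by an explicit inequality, since the hyperbolic density of \<open>\<Omega>\<close> at \<open>z\<close>
  is a constant multiple of \<open>1 / sqrt (|z| (|z| - Re z))\<close>.
\<close>

subsection \<open>Expansion of the hyperbolic metric of the slit plane\<close>

text \<open>\<open>k\<close> is sin b / b, with value 1 at b = 0. The quadratic bound on
  \<open>1 - k * cos b\<close> serves small \<open>m\<close> in \<open>one_minus_cos_bound\<close>,
  the bound by \<open>1 - k\<^sup>2\<close> large \<open>m\<close>.\<close>

lemma sinc_bounds:
  fixes b :: real
  assumes "b \<ge> 0"
  obtains k where "sin b = k * b" "k\<^sup>2 \<le> 1" "1 - k * cos b \<le> 2 * b\<^sup>2 / 3" "1 - k * cos b \<le> 6 * (1 - k\<^sup>2)"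
proof (cases "b = 0")
  case True
  then show ?thesis using that[of 1] by simp
next
  case False
  with assms have b: "b > 0" by simp
  define k where "k = sin b / b"
  have kb: "sin b = k * b" using b by (simp add: k_def)
  have k1: "\<bar>k\<bar> \<le> 1" using b abs_sin_x_le_abs_x[of b] by (simp add: k_def)
  \<comment> \<open>\<open>k * cos b\<close> equals sin(2b) / (2b), so the quadratic bound is the
    Taylor bound for sine at 2b.\<close>
  have "\<bar>sin (2*b) - (\<Sum>m<3. sin_coeff m * (2*b) ^ m)\<bar> \<le> inverse (fact 3) * \<bar>2*b\<bar> ^ 3"
    by (rule Maclaurin_sin_bound)
  moreover have "(\<Sum>m<3. sin_coeff m * (2*b) ^ m) = 2*b"
    by (simp add: numeral_eq_Suc sin_coeff_def)
  moreover have "inverse (fact 3) * \<bar>2*b\<bar> ^ 3 = (2*b)^3/6"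
    using b by (simp add: fact_numeral)
  ultimately have "sin (2*b) \<ge> 2*b - (2*b)^3/6"
    by linarith
  then have "2 * b * (k * cos b) \<ge> 2 * b * (1 - 2 * b\<^sup>2 / 3)"
    unfolding sin_double kb by (simp add: field_simps power2_eq_square power3_eq_cube)
  then have 1: "1 - k * cos b \<le> 2 * b\<^sup>2 / 3"
    using b by simp
  have 2: "1 - k * cos b \<le> 6 * (1 - k\<^sup>2)"
  \<comment> \<open>From 6/5 on, |k| <= 1/b <= 5/6 makes 6 (1 - |k|) at least 1. Below, the next
    Taylor bound gives \<open>1 - k \<ge> b\<^sup>2 / 9\<close>, and six times this is exactly the
    quadratic bound.\<close>
  proof (cases "b \<ge> 6/5")
    case True
    have "\<bar>k\<bar> \<le> 1 / b" using b abs_sin_le_one[of b] by (simp add: k_def divide_right_mono)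
    also have "\<dots> \<le> 5/6" using True b by (simp add: field_simps)
    finally have k: "\<bar>k\<bar> \<le> 5/6" .
    have "\<bar>k * cos b\<bar> \<le> \<bar>k\<bar> * 1" unfolding abs_mult by (rule mult_left_mono) auto
    then have "1 - k * cos b \<le> 1 + \<bar>k\<bar>" by linarith
    also have "\<dots> \<le> (6 * (1 - \<bar>k\<bar>)) * (1 + \<bar>k\<bar>)"
      using k mult_right_mono[of 1 "6 * (1 - \<bar>k\<bar>)" "1 + \<bar>k\<bar>"] by simp
    also have "\<dots> = 6 * (1 - k\<^sup>2)" by (simp add: algebra_simps power2_eq_square)
    finally show ?thesis .
  next
    case False
    have "\<bar>sin b - (\<Sum>m<5. sin_coeff m * b ^ m)\<bar> \<le> inverse (fact 5) * \<bar>b\<bar> ^ 5"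
      by (rule Maclaurin_sin_bound)
    moreover have "(\<Sum>m<5. sin_coeff m * b ^ m) = b - b^3/6"
      by (simp add: eval_nat_numeral sin_coeff_Suc cos_coeff_Suc)
    moreover have "inverse (fact 5) * \<bar>b\<bar> ^ 5 = b^5/120"
      using b by (simp add: fact_numeral)
    ultimately have "sin b \<le> b - b^3/6 + b^5/120"
      by linarith
    then have "b * k \<le> b * (1 - b\<^sup>2/6 + b\<^sup>2 * b\<^sup>2/120)"
      unfolding kb by (simp add: field_simps eval_nat_numeral)
    then have ku: "k \<le> 1 - b\<^sup>2/6 + b\<^sup>2 * b\<^sup>2/120" using b by simp
    have "b\<^sup>2 \<le> (6/5)\<^sup>2" using False b by (intro power_mono) auto
    then have "b\<^sup>2 * b\<^sup>2 \<le> b\<^sup>2 * (36/25)"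
      by (intro mult_left_mono) (auto simp: power2_eq_square)
    with ku have k2: "1 - k \<ge> b\<^sup>2 / 9" using zero_le_power2[of b] by linarith
    have k0: "k \<ge> 0" using b False sin_ge_zero[of b] pi_gt3 by (simp add: k_def)
    have "1 - k\<^sup>2 \<ge> 1 - k" using k0 k1 by (simp add: power2_eq_square mult_left_le)
    with 1 k2 show ?thesis by simp
  qed
  have "k\<^sup>2 \<le> 1" using k1 by (simp add: abs_square_le_1)
  with kb 1 2 that show ?thesis by blast
qed

text \<open>
  In the triangle with vertices \<open>0\<close>, \<open>-1\<close>, \<open>z\<close> let \<open>\<alpha>\<close> be the angle at \<open>z\<close> and \<open>m = |z| |z + 1|\<close>. Then
  \<open>m sin \<alpha> = |Im z|\<close>, the argument of \<open>\<zeta>(z)\<close> is \<open>\<alpha> - m sin \<alpha>\<close> up to sign, and the last factor below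
  is \<open>|1 - z (z + 1)|^2\<close>.
\<close>

lemma one_minus_cos_bound:
  fixes \<alpha> m :: real
  assumes "0 \<le> \<alpha>" "\<alpha> \<le> pi" "m \<ge> 0"
  shows "1 - cos (\<alpha> - m * sin \<alpha>) \<le> (1 - cos \<alpha>) * (1 + m\<^sup>2 - 2 * m * cos \<alpha> + 4 * (m * sin \<alpha>)\<^sup>2)"
proof -
  define s c where "s = sin (\<alpha>/2)" and "c = cos (\<alpha>/2)"
  \<comment> \<open>Half of \<open>m * sin \<alpha>\<close>. As sin b = k m s c, the factor
    \<open>s\<close> comes out of \<open>sin (\<alpha>/2 - b)\<close>, and both sides acquire the
    common factor \<open>2 * s\<^sup>2\<close>.\<close>
  define b where "b = m * s * c"
  have sc: "s\<^sup>2 = 1 - c\<^sup>2" by (simp add: s_def c_def sin_squared_eq)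
  have pos: "s \<ge> 0" "c \<ge> 0" using assms by (auto simp: s_def c_def intro!: sin_ge_zero cos_ge_zero)
  have c1: "c\<^sup>2 \<le> 1" "0 \<le> c\<^sup>2" using sc zero_le_power2[of s] by simp_all
  have "b \<ge> 0" using pos assms by (simp add: b_def)
  then obtain k where k: "sin b = k * b" "k\<^sup>2 \<le> 1" "1 - k * cos b \<le> 2 * b\<^sup>2 / 3" "1 - k * cos b \<le> 6 * (1 - k\<^sup>2)"
    by (rule sinc_bounds)
  have sa: "sin \<alpha> = 2 * s * c" and ca: "cos \<alpha> = 1 - 2 * s\<^sup>2"
    using sin_double[of "\<alpha>/2"] cos_double_sin[of "\<alpha>/2"] by (simp_all add: s_def c_def)
  have "1 - cos (\<alpha> - m * sin \<alpha>) = 2 * (sin (\<alpha>/2 - b))\<^sup>2"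
    using cos_double_sin[of "\<alpha>/2 - b"] by (simp add: sa b_def algebra_simps)
  also have "sin (\<alpha>/2 - b) = s * (cos b - k * m * c\<^sup>2)"
    unfolding sin_diff k(1) by (simp add: s_def [symmetric] c_def [symmetric] b_def algebra_simps power2_eq_square)
  finally have lhs: "1 - cos (\<alpha> - m * sin \<alpha>) = 2 * s\<^sup>2 * (cos b - k * m * c\<^sup>2)\<^sup>2"
    by (simp add: power_mult_distrib)
  have rhs: "1 + m\<^sup>2 - 2 * m * cos \<alpha> + 4 * (m * sin \<alpha>)\<^sup>2 = 1 + m\<^sup>2 - 2 * m * c\<^sup>2 + 2 * m * s\<^sup>2 + 16 * b\<^sup>2"
    unfolding sa ca b_def sc by (simp add: algebra_simps power2_eq_square)
  \<comment> \<open>What remains after cancelling \<open>2 * s\<^sup>2\<close>, bounding cos^2 b and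
    c^4 by 1 and dropping \<open>2 * m * s\<^sup>2\<close>.\<close>
  have key: "2 * m * c\<^sup>2 * (1 - k * cos b) \<le> m\<^sup>2 * (1 - k\<^sup>2) + 16 * b\<^sup>2"
  proof (cases "1 - k * cos b \<ge> 0")
    case False
    then have "2 * m * c\<^sup>2 * (1 - k * cos b) \<le> 0"
      using assms by (intro mult_nonneg_nonpos) auto
    moreover have "m\<^sup>2 * (1 - k\<^sup>2) \<ge> 0" using k by simp
    ultimately show ?thesis by (smt (verit) zero_le_power2)
  next
    case True
    have "c\<^sup>2 * (2 * m * (1 - k * cos b)) \<le> 1 * (2 * m * (1 - k * cos b))"
      using c1 True assms by (intro mult_right_mono) auto
    then have 1: "2 * m * c\<^sup>2 * (1 - k * cos b) \<le> 2 * m * (1 - k * cos b)"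
      by (simp add: algebra_simps)
    show ?thesis
    \<comment> \<open>The two bounds meet at 12: 4 m b^2 / 3 <= 16 b^2 holds up to m = 12, and 12 m
      <= m^2 from there on.\<close>
    proof (cases "m \<le> 12")
      case True
      have "2 * m * (1 - k * cos b) \<le> 2 * m * (2 * b\<^sup>2 / 3)"
        using k assms by (intro mult_left_mono) auto
      also have "\<dots> \<le> 2 * 12 * (2 * b\<^sup>2 / 3)" using True by (intro mult_right_mono) auto
      finally have "2 * m * (1 - k * cos b) \<le> 16 * b\<^sup>2" by simp
      moreover have "m\<^sup>2 * (1 - k\<^sup>2) \<ge> 0" using k by simp
      ultimately show ?thesis using 1 by linarith
    next
      case False
      have "2 * m * (1 - k * cos b) \<le> 2 * m * (6 * (1 - k\<^sup>2))"
        using k assms by (intro mult_left_mono) auto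
      also have "\<dots> = 12 * (m * (1 - k\<^sup>2))" by simp
      also have "\<dots> \<le> m * (m * (1 - k\<^sup>2))" using False k by (intro mult_right_mono) auto
      also have "\<dots> = m\<^sup>2 * (1 - k\<^sup>2)" by (simp add: power2_eq_square)
      finally show ?thesis using 1 zero_le_power2[of b] by linarith
    qed
  qed
  have "(k * m * c\<^sup>2)\<^sup>2 = (k\<^sup>2 * m\<^sup>2) * (c\<^sup>2 * c\<^sup>2)" by (simp add: power2_eq_square)
  also have "\<dots> \<le> (k\<^sup>2 * m\<^sup>2) * 1" using c1 by (intro mult_left_mono mult_le_one) auto
  finally have "(k * m * c\<^sup>2)\<^sup>2 \<le> k\<^sup>2 * m\<^sup>2" by simp
  moreover have "(cos b)\<^sup>2 \<le> 1" by (simp add: abs_square_le_1)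
  moreover have "2 * m * s\<^sup>2 \<ge> 0" using assms by simp
  moreover have "(cos b - k * m * c\<^sup>2)\<^sup>2 = (cos b)\<^sup>2 - 2 * m * c\<^sup>2 * (k * cos b) + (k * m * c\<^sup>2)\<^sup>2"
    by (simp add: power2_diff)
  ultimately have "(cos b - k * m * c\<^sup>2)\<^sup>2 \<le> 1 + m\<^sup>2 - 2 * m * c\<^sup>2 + 2 * m * s\<^sup>2 + 16 * b\<^sup>2"
    using key by (simp add: algebra_simps)
  then have "2 * s\<^sup>2 * (cos b - k * m * c\<^sup>2)\<^sup>2 \<le> 2 * s\<^sup>2 * (1 + m\<^sup>2 - 2 * m * c\<^sup>2 + 2 * m * s\<^sup>2 + 16 * b\<^sup>2)"
    by (intro mult_left_mono) auto
  then show ?thesis unfolding lhs rhs by (simp add: ca)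
qed

text \<open>At the pole \<open>-1\<close> this takes the junk value 0, so orbits through \<open>-1\<close> have to be excluded by hand.\<close>

definition zmap :: "real \<Rightarrow> complex \<Rightarrow> complex" where
  "zmap lam z = complex_of_real lam * (z / (z + 1)) * exp (- z)"

text \<open>Up to a constant, the inverse square of the hyperbolic density of the slit plane. With
  \<open>p = csqrt (- z)\<close> it equals 2 |p|^2 (Re p)^2.\<close>

definition slit_weight :: "complex \<Rightarrow> real" where
  "slit_weight z = cmod z * (cmod z - Re z)"

text \<open>The derivative of \<open>zmap\<close>, its numerator written so that the squared modulus
  is the factor in \<open>one_minus_cos_zmap_bound\<close>.\<close>

definition zmap' :: "real \<Rightarrow> complex \<Rightarrow> complex" where
  "zmap' lam z = complex_of_real lam * exp (- z) * (1 - z * (z + 1)) / (z + 1)\<^sup>2"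

lemma has_field_derivative_zmap:
  assumes "z \<noteq> -1"
  shows "(zmap lam has_field_derivative zmap' lam z) (at z)"
proof -
  have "z + 1 \<noteq> 0" using assms by (simp add: add_eq_0_iff2)
  then show ?thesis unfolding zmap_def zmap'_def
    by (auto intro!: derivative_eq_intros simp: field_simps power2_eq_square)
qed

lemma cmod_zmap: "cmod (zmap lam z) = \<bar>lam\<bar> * (cmod z / cmod (z + 1)) * exp (- Re z)"
  by (simp add: zmap_def norm_mult norm_divide)

text \<open>The fraction is the cosine of the argument of \<open>zmap lam z\<close>, namely of the
  argument of \<open>z * cnj (z + 1)\<close> turned by \<open>- Im z\<close>. That product has real
  part \<open>(cmod z)\<^sup>2 + Re z\<close> and imaginary part \<open>Im z\<close>.\<close>

lemma Re_zmap:
  assumes "z \<noteq> 0" "z \<noteq> -1" "0 < lam"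
  shows "Re (zmap lam z) = cmod (zmap lam z) *
    (((cmod z)\<^sup>2 + Re z) * cos (Im z) + Im z * sin (Im z)) / (cmod z * cmod (z + 1))"
proof -
  have nz: "z + 1 \<noteq> 0" "cmod z \<noteq> 0" "cmod (z+1) \<noteq> 0" using assms by (auto simp: add_eq_0_iff2)
  have "z / (z + 1) = z * cnj (z + 1) / of_real ((cmod (z + 1))\<^sup>2)"
    using complex_div_cnj[of z "z+1"] by simp
  then have "zmap lam z = of_real (lam / (cmod (z + 1))\<^sup>2) * (z * cnj (z + 1) * exp (- z))"
    by (simp add: zmap_def)
  then have "Re (zmap lam z) = lam / (cmod (z + 1))\<^sup>2 * Re (z * cnj (z + 1) * exp (- z))"
    by (simp only: Re_complex_of_real Im_complex_of_real times_complex.simps)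
  also have "Re (z * cnj (z + 1) * exp (- z)) = exp (- Re z) *
      (((cmod z)\<^sup>2 + Re z) * cos (Im z) + Im z * sin (Im z))"
    unfolding cmod_power2 by (simp add: Re_exp Im_exp algebra_simps power2_eq_square)
  finally show ?thesis using nz assms by (simp add: cmod_zmap power2_eq_square)
qed

text \<open>This is \<open>one_minus_cos_bound\<close> in Cartesian form, \<open>c\<close> being the
  cosine of the angle at \<open>z\<close>.\<close>

lemma one_minus_cos_zmap_bound:
  assumes "z \<noteq> 0" "z \<noteq> -1"
  shows "1 - (((cmod z)\<^sup>2 + Re z) * cos (Im z) + Im z * sin (Im z)) / (cmod z * cmod (z + 1))
    \<le> (1 - ((cmod z)\<^sup>2 + Re z) / (cmod z * cmod (z + 1))) * (cmod (1 - z * (z + 1)))\<^sup>2"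
proof -
  \<comment> \<open>The absolute value in \<open>y\<close> fits \<open>sin \<alpha> \<ge> 0\<close>
    on [0, pi]; the final expression is even in \<open>Im z\<close>.\<close>
  define m c y where "m = cmod z * cmod (z + 1)" and "c = ((cmod z)\<^sup>2 + Re z) / m" and "y = \<bar>Im z\<bar>"
  have m: "m > 0" using assms by (simp add: m_def add_eq_0_iff2)
  have "m\<^sup>2 = (cmod z)\<^sup>2 * (cmod (z + 1))\<^sup>2" by (simp add: m_def power_mult_distrib)
  also have "\<dots> = ((cmod z)\<^sup>2 + Re z)\<^sup>2 + (Im z)\<^sup>2"
    unfolding cmod_power2 by (simp add: algebra_simps power2_eq_square)
  finally have m2: "m\<^sup>2 = ((cmod z)\<^sup>2 + Re z)\<^sup>2 + (Im z)\<^sup>2" .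
  have mc: "m * c = (cmod z)\<^sup>2 + Re z" using m by (simp add: c_def)
  have c2: "1 - c\<^sup>2 = (y / m)\<^sup>2"
  proof -
    have "m\<^sup>2 * (1 - c\<^sup>2) = y\<^sup>2" using m2 unfolding mc[symmetric]
      by (simp add: algebra_simps y_def power_mult_distrib)
    then show ?thesis using m by (simp add: field_simps)
  qed
  then have "c\<^sup>2 \<le> 1" using zero_le_power2[of "y/m"] by linarith
  then have c1: "\<bar>c\<bar> \<le> 1" by (simp add: abs_square_le_1)
  define \<alpha> where "\<alpha> = arccos c"
  have ca: "cos \<alpha> = c" using c1 by (simp add: \<alpha>_def cos_arccos_abs)
  have "sin \<alpha> = y / m"
    using c1 c2 m by (simp add: \<alpha>_def sin_arccos_abs y_def)
  then have msa: "m * sin \<alpha> = y" and sa: "sin \<alpha> = y / m" using m by auto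
  have bnd: "0 \<le> \<alpha>" "\<alpha> \<le> pi" using c1 by (auto simp: \<alpha>_def intro!: arccos_lbound arccos_ubound)
  have "(cmod (1 - z * (z + 1)))\<^sup>2 = 1 + m\<^sup>2 - 2 * (m * c) + 4 * (Im z)\<^sup>2"
    unfolding mc m2 cmod_power2 by (simp add: algebra_simps power2_eq_square)
  moreover have "1 - cos (\<alpha> - y) \<le> (1 - c) * (1 + m\<^sup>2 - 2 * m * c + 4 * y\<^sup>2)"
    using one_minus_cos_bound[OF bnd, of m] m unfolding msa ca by simp
  moreover have "cos (\<alpha> - y) = c * cos (Im z) + (Im z * sin (Im z)) / m"
    unfolding cos_diff ca sa by (auto simp: y_def abs_if)
  ultimately have "1 - (c * cos (Im z) + (Im z * sin (Im z)) / m) \<le> (1 - c) * (cmod (1 - z * (z + 1)))\<^sup>2"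
    by (simp add: y_def mult.assoc)
  moreover have "((m * c) * cos (Im z) + Im z * sin (Im z)) / m = c * cos (Im z) + (Im z * sin (Im z)) / m"
    using m by (simp add: add_divide_distrib)
  ultimately show ?thesis unfolding mc by (simp only: m_def[symmetric] c_def[symmetric])
qed

text \<open>Source of the strict expansion. With r = |z|, q = |z + 1|, x = Re z, the first factor
  times its conjugate r q + r^2 + x is (r - x)(r + x), so it suffices to bound (r + x)(q + (r -
  x)/2) by the conjugate.\<close>

lemma angle_gain:
  assumes "z \<noteq> 0" "z \<noteq> -1"
  shows "(cmod z * cmod (z + 1) - (cmod z)\<^sup>2 - Re z) * (cmod (z + 1) + (cmod z - Re z) / 2)
    \<le> cmod z - Re z"
proof -
  define r q x where "r = cmod z" and "q = cmod (z + 1)" and "x = Re z"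
  have pos: "r > 0" "q > 0" using assms by (auto simp: r_def q_def add_eq_0_iff2)
  have q2: "q\<^sup>2 = r\<^sup>2 + 2 * x + 1"
    unfolding q_def r_def x_def cmod_power2 by (simp add: algebra_simps power2_eq_square)
  have xr: "\<bar>x\<bar> \<le> r" using abs_Re_le_cmod by (simp add: x_def r_def)
  have qr: "q \<le> 1 + r" using norm_triangle_ineq[of z 1] by (simp add: q_def r_def)
  have qx: "1 + x \<le> q" using complex_Re_le_cmod[of "z+1"] by (simp add: q_def x_def)
  have pr: "(r * q - r\<^sup>2 - x) * (r * q + r\<^sup>2 + x) = (r - x) * (r + x)"
  proof -
    have "(r * q - r\<^sup>2 - x) * (r * q + r\<^sup>2 + x) = r\<^sup>2 * q\<^sup>2 - (r\<^sup>2 + x)\<^sup>2"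
      by (simp add: algebra_simps power2_eq_square)
    then show ?thesis unfolding q2 by (simp add: algebra_simps power2_eq_square)
  qed
  have main: "(r + x) * (q + (r - x) / 2) \<le> r * q + r\<^sup>2 + x"
  proof -
    have "q * x + (r - x) * (r + x) / 2 \<le> r\<^sup>2 + x"
    \<comment> \<open>The sign of \<open>x\<close> decides whether \<open>q \<le> 1 + r\<close> or
      \<open>1 + x \<le> q\<close> bounds \<open>q * x\<close> from above.\<close>
    proof (cases "x \<ge> 0")
      case True
      have "q * x \<le> (1 + r) * x" using True qr by (rule mult_right_mono[rotated])
      moreover have "(r - x) * (r + x) \<le> (r - x) * (2 * r)" using xr by (intro mult_left_mono) auto
      moreover have "r\<^sup>2 + x - (1 + r) * x = (r - x) * (2 * r) / 2" by (simp add: algebra_simps power2_eq_square)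
      ultimately show ?thesis by linarith
    next
      case False
      have "q * x \<le> (1 + x) * x" using False qx by (intro mult_right_mono_neg) auto
      moreover have "(r - x) * (r + x) \<ge> 0" using xr by (intro mult_nonneg_nonneg) auto
      moreover have "r\<^sup>2 + x - (1 + x) * x = (r - x) * (r + x)" by (simp add: algebra_simps power2_eq_square)
      ultimately show ?thesis by linarith
    qed
    then show ?thesis by (simp add: algebra_simps)
  qed
  have "(r * q - r\<^sup>2 - x) * (q + (r - x) / 2) \<le> r - x"
  proof (cases "r * q + r\<^sup>2 + x > 0")
    case True
    have "((r * q - r\<^sup>2 - x) * (q + (r - x) / 2)) * (r * q + r\<^sup>2 + x) = ((r * q - r\<^sup>2 - x) * (r * q + r\<^sup>2 + x)) * (q + (r - x) / 2)"
      by (simp only: mult_ac)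
    also have "\<dots> = (r - x) * ((r + x) * (q + (r - x) / 2))"
      unfolding pr by (simp only: mult_ac)
    also have "\<dots> \<le> (r - x) * (r * q + r\<^sup>2 + x)" using xr main by (intro mult_left_mono) auto
    finally show ?thesis using True by simp
  next
    \<comment> \<open>The conjugate vanishes here, which puts \<open>z\<close> on the segment
      between -1 and 0. Division is impossible, and the claim is checked directly.\<close>
    case False
    have "(r * q + r\<^sup>2 + x) \<ge> 0"
      using xr pos by (intro order_trans[OF _ main] mult_nonneg_nonneg) auto
    with False have e: "r * q + r\<^sup>2 + x = 0" by simp
    have "r \<noteq> x"
    proof
      assume "r = x"
      then have "r * q + r\<^sup>2 + x > 0" using pos by (intro add_pos_pos mult_pos_pos) auto
      with e show False by simp
    qed
    moreover have "(r - x) * (r + x) = 0" unfolding pr[symmetric] e by simp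
    ultimately have "r = - x" by auto
    moreover have "r * q = r * (1 - r)" using e \<open>r = -x\<close> by (simp add: algebra_simps power2_eq_square)
    then have "q = 1 - r" using pos by simp
    ultimately have "(r * q - r\<^sup>2 - x) * (q + (r - x) / 2) = 2 * r * (1 - r)" by (simp add: algebra_simps power2_eq_square)
    also have "\<dots> \<le> r - x" using \<open>r = -x\<close> pos by (simp add: algebra_simps)
    finally show ?thesis .
  qed
  then show ?thesis by (simp add: r_def q_def x_def)
qed

text \<open>Combines the argument bound with \<open>angle_gain\<close>. Off the half-line it bounds
  the squared hyperbolic derivative from below by the bracketed factor; avoiding division keeps it
  meaningful where a weight vanishes.\<close>

lemma zmap_expanding:
  assumes "z \<noteq> 0" "z \<noteq> -1" "0 < lam"
  shows "(1 + (cmod z - Re z) / (2 * cmod (z + 1))) * slit_weight (zmap lam z) \<le> (cmod (zmap' lam z))\<^sup>2 * slit_weight z"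
proof -
  define r q x where "r = cmod z" and "q = cmod (z + 1)" and "x = Re z"
  define A where "A = (cmod (1 - z * (z + 1)))\<^sup>2"
  define g where "g = 1 + (r - x) / (2 * q)"
  define M where "M = (cmod (zmap lam z))\<^sup>2"
  have pos: "r > 0" "q > 0" using assms by (auto simp: r_def q_def add_eq_0_iff2)
  have g: "g \<ge> 0" using pos complex_Re_le_cmod[of z] by (simp add: g_def r_def x_def)
  define C where "C = ((r\<^sup>2 + x) * cos (Im z) + Im z * sin (Im z)) / (r * q)"
  have "Re (zmap lam z) = cmod (zmap lam z) * C"
    using Re_zmap[OF assms] by (simp add: C_def r_def q_def x_def)
  then have s: "slit_weight (zmap lam z) = M * (1 - C)"
    by (simp add: slit_weight_def M_def power2_eq_square algebra_simps)
  have Z: "(cmod (zmap' lam z))\<^sup>2 = M * A / (r\<^sup>2 * q\<^sup>2)"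
    using pos by (simp add: M_def cmod_zmap zmap'_def A_def[symmetric] norm_mult norm_divide norm_power
        r_def[symmetric] q_def[symmetric] power_mult_distrib power_divide power2_eq_square[of "q\<^sup>2"])
  have "1 - C \<le> (1 - (r\<^sup>2 + x) / (r * q)) * A"
    using one_minus_cos_zmap_bound[OF assms(1,2)] by (simp add: C_def r_def q_def x_def A_def)
  then have "g * (1 - C) \<le> g * ((1 - (r\<^sup>2 + x) / (r * q)) * A)" using g by (rule mult_left_mono)
  also have "\<dots> = (r * q - r\<^sup>2 - x) * (q + (r - x) / 2) * (A / (r * q\<^sup>2))"
    using pos by (simp add: g_def field_simps power2_eq_square)
  also have "\<dots> \<le> (r - x) * (A / (r * q\<^sup>2))"
    using angle_gain[OF assms(1,2)] pos by (intro mult_right_mono) (auto simp: r_def q_def x_def A_def)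
  finally have "M * (g * (1 - C)) \<le> M * ((r - x) * (A / (r * q\<^sup>2)))"
    by (rule mult_left_mono) (simp add: M_def)
  also have "\<dots> = (cmod (zmap' lam z))\<^sup>2 * slit_weight z"
    unfolding Z slit_weight_def r_def[symmetric] x_def[symmetric] using pos by (simp add: power2_eq_square field_simps)
  finally show ?thesis unfolding s by (simp add: g_def r_def q_def x_def mult_ac)
qed

section \<open>A Schwarz-Pick bound for maps into the slit plane\<close>

lemma slit_weight_nonneg: "slit_weight z \<ge> 0"
  using complex_Re_le_cmod[of z] by (simp add: slit_weight_def)

lemma slit_weight_eq_0_iff: "slit_weight z = 0 \<longleftrightarrow> z \<in> \<real>\<^sub>\<ge>\<^sub>0"
proof -
  have "cmod z = Re z \<longleftrightarrow> z \<in> \<real>\<^sub>\<ge>\<^sub>0"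
  proof
    assume e: "cmod z = Re z"
    then have "Im z = 0" using cmod_power2[of z] by simp
    moreover have "Re z \<ge> 0" using e norm_ge_zero[of z] by linarith
    ultimately show "z \<in> \<real>\<^sub>\<ge>\<^sub>0" by (simp add: complex_nonneg_Reals_iff)
  qed (auto elim: nonneg_Reals_cases)
  then show ?thesis by (auto simp: slit_weight_def)
qed

text \<open>The constant is not sharp: Cauchy's inequality is applied on the ball of half the radius.\<close>

lemma slit_Schwarz_Pick:
  assumes hol: "F holomorphic_on ball z0 R" and R: "R > 0"
    and avoid: "\<And>z. z \<in> ball z0 R \<Longrightarrow> F z \<notin> \<real>\<^sub>\<ge>\<^sub>0"
    and der: "(F has_field_derivative D) (at z0)"
  shows "(cmod D)\<^sup>2 \<le> 32 / R\<^sup>2 * slit_weight (F z0)"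
proof -
  \<comment> \<open>The square root of \<open>- F\<close> takes values in the right half-plane;
    \<open>C\<close> follows it by the Cayley transform that sends \<open>p\<close> to 0 and the
    half-plane into the unit disc.\<close>
  define \<phi> where "\<phi> z = csqrt (- F z)" for z
  define p where "p = \<phi> z0"
  define C where "C z = (\<phi> z - p) / (\<phi> z + cnj p)" for z
  have npos: "- F z \<notin> \<real>\<^sub>\<le>\<^sub>0" if "z \<in> ball z0 R" for z
    using avoid[OF that] by (simp add: complex_nonpos_Reals_iff complex_nonneg_Reals_iff)
  have Repos: "Re (\<phi> z) > 0" if "z \<in> ball z0 R" for z
  proof -
    have "cmod (F z) - Re (F z) \<noteq> 0" 
      using avoid[OF that] slit_weight_eq_0_iff[of "F z"] by (auto simp: slit_weight_def)
    then show ?thesis using complex_Re_le_cmod[of "F z"] by (simp add: \<phi>_def)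
  qed
  have z0: "z0 \<in> ball z0 R" using R by simp
  have p: "Re p > 0" using Repos[OF z0] by (simp add: p_def)
  have nz: "\<phi> z + cnj p \<noteq> 0" if "z \<in> ball z0 R" for z
    using Repos[OF that] p by (auto simp: complex_eq_iff)
  have hol\<phi>: "\<phi> holomorphic_on ball z0 R"
    unfolding \<phi>_def using npos by (intro holomorphic_intros hol) auto
  have holC: "C holomorphic_on ball z0 R"
    unfolding C_def using nz by (intro holomorphic_intros hol\<phi>) auto
  have C1: "cmod (C z) \<le> 1" if "z \<in> ball z0 R" for z
  proof -
    have "(cmod (\<phi> z - p))\<^sup>2 \<le> (cmod (\<phi> z + cnj p))\<^sup>2"
      using Repos[OF that] p mult_pos_pos[OF Repos[OF that] p]
      unfolding cmod_power2 by (simp add: algebra_simps power2_eq_square)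
    then have "cmod (\<phi> z - p) \<le> cmod (\<phi> z + cnj p)" by (rule power2_le_imp_le) simp
    then show ?thesis using nz[OF that] by (simp add: C_def norm_divide)
  qed
  have "p \<noteq> 0" using p by auto
  have der\<phi>: "(\<phi> has_field_derivative (- D) / (2 * p)) (at z0)"
    unfolding \<phi>_def p_def using npos[OF z0]
    by (auto intro!: derivative_eq_intros der simp: field_simps)
  have pp: "p + cnj p = of_real (2 * Re p)" by (simp add: complex_eq_iff)
  have "(C has_field_derivative ((- D) / (2 * p)) / of_real (2 * Re p)) (at z0)"
    unfolding C_def
    by (rule derivative_eq_intros der\<phi> refl)+
       (use nz[OF z0] p in \<open>auto simp: p_def[symmetric] pp\<close>)
  then have dC: "deriv C z0 = ((- D) / (2 * p)) / of_real (2 * Re p)"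
    by (rule DERIV_imp_deriv)
  have "cmod ((deriv ^^ 1) C z0) \<le> fact 1 * 1 / (R/2) ^ 1"
  proof (rule Cauchy_inequality)
    show "C holomorphic_on ball z0 (R/2)" using R by (intro holomorphic_on_subset[OF holC]) auto
    show "continuous_on (cball z0 (R/2)) C"
      using R by (intro continuous_on_subset[OF holomorphic_on_imp_continuous_on[OF holC]]) auto
    show "cmod (C x) \<le> 1" if "cmod (z0 - x) = R/2" for x
      using that R by (intro C1) (simp add: dist_norm)
  qed (use R in auto)
  then have "cmod D / (4 * cmod p * Re p) \<le> 2 / R"
    using p by (simp add: dC norm_mult norm_divide)
  then have "(cmod D / (4 * cmod p * Re p))\<^sup>2 \<le> (2 / R)\<^sup>2"
    using p by (intro power_mono) auto
  then have "(cmod D)\<^sup>2 \<le> 4 / R\<^sup>2 * (16 * ((cmod p)\<^sup>2 * (Re p)\<^sup>2))"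
    using p \<open>p \<noteq> 0\<close> R by (simp add: power_divide power_mult_distrib field_simps)
  \<comment> \<open>|p|^2 is |F z0| and (Re p)^2 is half of |F z0| - Re (F z0). This half turns 4 *
    16 into 32.\<close>
  also have "(cmod p)\<^sup>2 * (Re p)\<^sup>2 = slit_weight (F z0) / 2"
    using complex_Re_le_cmod[of "F z0"] by (simp add: p_def \<phi>_def slit_weight_def)
  finally show ?thesis by simp
qed

section \<open>Regularity of the iterates away from the pole\<close>

lemma zmap_iter_holomorphic:
  assumes "\<And>z k. z \<in> S \<Longrightarrow> k < n \<Longrightarrow> (zmap lam ^^ k) z \<noteq> -1"
  shows "(zmap lam ^^ n) holomorphic_on S"
  using assms
proof (induction n)
  case 0
  then show ?case by (simp add: id_def holomorphic_on_ident)
next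
  case (Suc n)
  have "(zmap lam ^^ n) holomorphic_on S" using Suc by simp
  moreover have "zmap lam holomorphic_on -{-1}"
    by (rule holomorphic_onI) (auto simp: field_differentiable_def intro: has_field_derivative_at_within has_field_derivative_zmap)
  ultimately show ?case
    using holomorphic_on_compose_gen[of "zmap lam ^^ n" S "zmap lam" "-{-1}"] Suc.prems
    by (force simp: o_def)
qed

lemma isCont_zmap_iter:
  assumes "\<And>k. k < n \<Longrightarrow> (zmap lam ^^ k) z \<noteq> -1"
  shows "isCont (zmap lam ^^ n) z"
  using assms
proof (induction n)
  case (Suc n)
  have "isCont (zmap lam) ((zmap lam ^^ n) z)"
    using Suc.prems by (intro DERIV_isCont[OF has_field_derivative_zmap]) auto
  moreover have "isCont (zmap lam ^^ n) z" using Suc by simp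
  ultimately show ?case using isCont_o2[of z "zmap lam ^^ n" "zmap lam"] by simp
qed (simp add: id_def)

lemma zmap_iter_derivative:
  assumes "\<And>k. k < n \<Longrightarrow> (zmap lam ^^ k) z \<noteq> -1"
  shows "((zmap lam ^^ n) has_field_derivative (\<Prod>k<n. zmap' lam ((zmap lam ^^ k) z))) (at z)"
  using assms
proof (induction n)
  case (Suc n)
  have "(zmap lam has_field_derivative zmap' lam ((zmap lam ^^ n) z)) (at ((zmap lam ^^ n) z))"
    using Suc.prems by (intro has_field_derivative_zmap) auto
  from DERIV_chain[OF this Suc.IH] Suc.prems show ?case by (simp add: mult.commute o_def)
qed (simp add: id_def)

subsection \<open>The basin in the finite plane\<close>

text \<open>The finite part of \<open>basin0\<close>. The first condition removes the preimages of
  the pole, whose \<open>zmap\<close> orbits would end at the fixed point 0.\<close>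

definition fbasin :: "real \<Rightarrow> complex set" where
  "fbasin lam = {z. (\<forall>k. (zmap lam ^^ k) z \<noteq> -1) \<and> (\<lambda>n. (zmap lam ^^ n) z) \<longlonglongrightarrow> 0}"

text \<open>|zmap lam z| / |z| is lam exp(- Re z) / |z + 1|, which tends to lam at 0, so any
  \<open>\<kappa>\<close> between lam and 1 works. \<open>d < 1\<close> keeps the pole out of the
  disc.\<close>

lemma attracting_disc:
  assumes "0 < lam" "lam < 1"
  obtains d \<kappa> where "0 < d" "d < 1" "0 < \<kappa>" "\<kappa> < 1" "\<And>z. cmod z < d \<Longrightarrow> cmod (zmap lam z) \<le> \<kappa> * cmod z"
proof -
  define \<kappa> where "\<kappa> = (1 + lam) / 2"
  have \<kappa>: "lam < \<kappa>" "\<kappa> < 1" "0 < \<kappa>" using assms by (auto simp: \<kappa>_def)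
  have "isCont (\<lambda>z. lam * exp (- Re z) / cmod (z + 1)) 0"
    by (intro continuous_intros) auto
  then have "((\<lambda>z. lam * exp (- Re z) / cmod (z + 1)) \<longlongrightarrow> lam) (nhds 0)"
    using tendsto_at_iff_tendsto_nhds[of "\<lambda>z. lam * exp (- Re z) / cmod (z + 1)" 0] by (simp add: isCont_def)
  then have "\<forall>\<^sub>F z in nhds 0. lam * exp (- Re z) / cmod (z + 1) < \<kappa>"
    using \<kappa> by (intro order_tendstoD) auto
  then obtain e where e: "e > 0" "\<And>z. cmod z < e \<Longrightarrow> lam * exp (- Re z) / cmod (z + 1) < \<kappa>"
    unfolding eventually_nhds_metric by (auto simp: dist_norm)
  show ?thesis
  proof (rule that[of "min e (1/2)" \<kappa>])
    fix z assume "cmod z < min e (1/2)"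
    then have "lam * exp (- Re z) / cmod (z + 1) * cmod z \<le> \<kappa> * cmod z"
      using e by (intro mult_right_mono) (auto simp: less_imp_le)
    then show "cmod (zmap lam z) \<le> \<kappa> * cmod z" using assms by (simp add: cmod_zmap mult_ac)
  qed (use e \<kappa> in auto)
qed

lemma funpow_contraction:
  fixes f :: "'a::real_normed_vector \<Rightarrow> 'a"
  assumes "0 < \<kappa>" "\<kappa> < 1" "\<And>z. norm z < d \<Longrightarrow> norm (f z) \<le> \<kappa> * norm z" "norm z < d"
  shows "norm ((f ^^ n) z) \<le> \<kappa> ^ n * norm z"
proof (induction n)
  case (Suc n)
  have "\<kappa> ^ n * norm z \<le> norm z" using assms by (simp add: mult_left_le_one_le power_le_one)
  then have "norm ((f ^^ n) z) < d" using Suc assms by linarith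
  then have "norm (f ((f ^^ n) z)) \<le> \<kappa> * norm ((f ^^ n) z)" using assms by blast
  also have "\<dots> \<le> \<kappa> * (\<kappa> ^ n * norm z)" using Suc assms by (intro mult_left_mono) auto
  finally show ?case by (simp add: mult_ac)
qed simp

text \<open>Both defining conditions concern the tail of the orbit. Only indices below
  \<open>n\<close> are restricted: if iterate \<open>n\<close> itself is -1, both sides are
  false.\<close>

lemma fbasin_iff_shift:
  assumes "\<And>k. k < n \<Longrightarrow> (zmap lam ^^ k) z \<noteq> -1"
  shows "z \<in> fbasin lam \<longleftrightarrow> (zmap lam ^^ n) z \<in> fbasin lam"
proof -
  have *: "(zmap lam ^^ k) ((zmap lam ^^ n) z) = (zmap lam ^^ (k + n)) z" for k
    by (simp add: funpow_add)
  have "(\<forall>k. (zmap lam ^^ k) z \<noteq> -1) \<longleftrightarrow> (\<forall>k. (zmap lam ^^ (k + n)) z \<noteq> -1)"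
  proof safe
    fix k assume "\<forall>k. (zmap lam ^^ (k + n)) z \<noteq> -1" "(zmap lam ^^ k) z = -1"
    then show False using assms[of k] by (cases "k < n") (auto dest!: spec[of _ "k - n"])
  qed blast
  moreover have "((\<lambda>k. (zmap lam ^^ (k + n)) z) \<longlonglongrightarrow> 0) \<longleftrightarrow> (\<lambda>k. (zmap lam ^^ k) z) \<longlonglongrightarrow> 0"
    using LIMSEQ_offset[of "\<lambda>k. (zmap lam ^^ k) z" n 0]
      LIMSEQ_ignore_initial_segment[of "\<lambda>k. (zmap lam ^^ k) z" 0 n] by blast
  ultimately show ?thesis by (simp add: fbasin_def *)
qed

lemma disc_subset_fbasin:
  assumes "d < 1" "0 < \<kappa>" "\<kappa> < 1" "\<And>z. cmod z < d \<Longrightarrow> cmod (zmap lam z) \<le> \<kappa> * cmod z" "cmod z < d"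
  shows "z \<in> fbasin lam"
proof -
  have bd: "cmod ((zmap lam ^^ n) z) \<le> \<kappa> ^ n * cmod z" for n
    by (rule funpow_contraction[of _ d]) (use assms in auto)
  have "(zmap lam ^^ n) z \<noteq> -1" for n
  proof
    assume "(zmap lam ^^ n) z = -1"
    moreover have "\<kappa> ^ n * cmod z \<le> cmod z" using assms by (simp add: mult_left_le_one_le power_le_one)
    ultimately show False using bd[of n] assms by simp
  qed
  moreover have "(\<lambda>n. (zmap lam ^^ n) z) \<longlonglongrightarrow> 0"
  proof (rule Lim_null_comparison)
    show "\<forall>\<^sub>F n in sequentially. cmod ((zmap lam ^^ n) z) \<le> \<kappa> ^ n * cmod z" using bd by simp
    show "(\<lambda>n. \<kappa> ^ n * cmod z) \<longlonglongrightarrow> 0"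
      using assms by (intro tendsto_mult_left_zero LIMSEQ_realpow_zero) auto
  qed
  ultimately show ?thesis by (simp add: fbasin_def)
qed

text \<open>Finitely many continuous conditions persist on a ball. One \<open>n\<close> for all
  nearby points gives openness of the basin and, later, uniform convergence.\<close>

lemma fbasin_local:
  assumes "z \<in> fbasin lam" "d > 0"
  obtains n r where "r > 0" "\<And>w k. w \<in> ball z r \<Longrightarrow> k < n \<Longrightarrow> (zmap lam ^^ k) w \<noteq> -1"
    "\<And>w. w \<in> ball z r \<Longrightarrow> cmod ((zmap lam ^^ n) w) < d"
proof -
  have "\<forall>\<^sub>F n in sequentially. dist ((zmap lam ^^ n) z) 0 < d"
    using assms tendstoD[of "\<lambda>n. (zmap lam ^^ n) z" 0 sequentially d] by (auto simp: fbasin_def)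
  then obtain n where n: "cmod ((zmap lam ^^ n) z) < d"
    by (auto simp: eventually_sequentially)
  have cont: "((zmap lam ^^ k) \<longlongrightarrow> (zmap lam ^^ k) z) (nhds z)" for k
    using isCont_zmap_iter[of k lam z] assms by (auto simp: fbasin_def isCont_def tendsto_at_iff_tendsto_nhds)
  have "\<forall>\<^sub>F w in nhds z. (zmap lam ^^ k) w \<noteq> -1" for k
    using tendsto_imp_eventually_ne[OF cont] assms by (auto simp: fbasin_def)
  then have "\<forall>\<^sub>F w in nhds z. \<forall>k\<in>{..<n}. (zmap lam ^^ k) w \<noteq> -1"
    by (simp add: eventually_ball_finite)
  moreover have "\<forall>\<^sub>F w in nhds z. cmod ((zmap lam ^^ n) w) < d"
    using order_tendstoD(2)[OF tendsto_norm[OF cont] n] .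
  ultimately have "\<forall>\<^sub>F w in nhds z. (\<forall>k<n. (zmap lam ^^ k) w \<noteq> -1) \<and> cmod ((zmap lam ^^ n) w) < d"
    by eventually_elim auto
  then show ?thesis using that unfolding eventually_nhds_metric by (auto simp: dist_commute)
qed

lemma open_fbasin:
  assumes "0 < lam" "lam < 1"
  shows "open (fbasin lam)"
proof -
  obtain d \<kappa> where d: "0 < d" "d < 1" "0 < \<kappa>" "\<kappa> < 1" "\<And>z. cmod z < d \<Longrightarrow> cmod (zmap lam z) \<le> \<kappa> * cmod z"
    using attracting_disc[OF assms] by blast
  show ?thesis unfolding open_contains_ball
  proof
    fix z assume "z \<in> fbasin lam"
    then obtain n r where r: "r > 0" "\<And>w k. w \<in> ball z r \<Longrightarrow> k < n \<Longrightarrow> (zmap lam ^^ k) w \<noteq> -1"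
      "\<And>w. w \<in> ball z r \<Longrightarrow> cmod ((zmap lam ^^ n) w) < d"
      by (rule fbasin_local[OF _ d(1)]) blast
    have "w \<in> fbasin lam" if "w \<in> ball z r" for w
      using fbasin_iff_shift[of n lam w] r that disc_subset_fbasin[OF d(2-5)] by blast
    with r show "\<exists>e>0. ball z e \<subseteq> fbasin lam" by blast
  qed
qed

section \<open>A neighbourhood of the half-line inside the basin\<close>

lemma nonneg_Reals_subset_fbasin:
  assumes "0 < lam" "lam < 1" "z \<in> \<real>\<^sub>\<ge>\<^sub>0"
  shows "z \<in> fbasin lam"
proof -
  have step: "zmap lam w \<in> \<real>\<^sub>\<ge>\<^sub>0 \<and> cmod (zmap lam w) \<le> lam * cmod w" if w: "w \<in> \<real>\<^sub>\<ge>\<^sub>0" for w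
  proof -
    obtain x where x: "w = of_real x" "x \<ge> 0" using w by (auto elim: nonneg_Reals_cases)
    have e: "zmap lam w = of_real (lam * (x / (x + 1)) * exp (- x))"
      by (simp add: zmap_def x exp_of_real flip: of_real_minus)
    have "x / (x + 1) * exp (- x) \<le> x * 1" using x by (intro mult_mono) (auto simp: divide_le_eq mult_left_mono algebra_simps)
    then have "lam * (x / (x + 1) * exp (- x)) \<le> lam * x" using assms by (intro mult_left_mono) auto
    then show ?thesis unfolding e norm_of_real using x assms by (simp add: abs_mult mult_ac del: of_real_mult of_real_divide)
  qed
  have *: "(zmap lam ^^ n) z \<in> \<real>\<^sub>\<ge>\<^sub>0 \<and> cmod ((zmap lam ^^ n) z) \<le> lam ^ n * cmod z" for n
  proof (induction n)
    case (Suc n)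
    have "lam * cmod ((zmap lam ^^ n) z) \<le> lam * (lam ^ n * cmod z)"
      using Suc assms by (intro mult_left_mono) auto
    then show ?case using step[of "(zmap lam ^^ n) z"] Suc by auto
  qed (use assms in auto)
  have "(zmap lam ^^ n) z \<noteq> -1" for n using *[of n] by (auto simp: complex_nonneg_Reals_iff)
  moreover have "(\<lambda>n. (zmap lam ^^ n) z) \<longlonglongrightarrow> 0"
  proof (rule Lim_null_comparison)
    show "\<forall>\<^sub>F n in sequentially. cmod ((zmap lam ^^ n) z) \<le> lam ^ n * cmod z" using * by simp
    show "(\<lambda>n. lam ^ n * cmod z) \<longlonglongrightarrow> 0"
      using assms by (intro tendsto_mult_left_zero LIMSEQ_realpow_zero) auto
  qed
  ultimately show ?thesis by (simp add: fbasin_def)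
qed

text \<open>With exp(-R) = d and |z| <= |z + 1|, a single step lands in the attracting disc.\<close>

lemma right_half_plane_subset_fbasin:
  assumes "0 < lam" "lam < 1"
  obtains R where "R > 0" "\<And>z. Re z \<ge> R \<Longrightarrow> z \<in> fbasin lam"
proof -
  obtain d \<kappa> where d: "0 < d" "d < 1" "0 < \<kappa>" "\<kappa> < 1" "\<And>z. cmod z < d \<Longrightarrow> cmod (zmap lam z) \<le> \<kappa> * cmod z"
    using attracting_disc[OF assms] by blast
  define R where "R = - ln d"
  have R: "R > 0" "exp (- R) = d" using d by (auto simp: R_def)
  show ?thesis
  proof (rule that[OF R(1)])
    fix z assume z: "Re z \<ge> R"
    then have ne: "z \<noteq> -1" using R by auto
    have "(cmod z)\<^sup>2 \<le> (cmod (z + 1))\<^sup>2" using z R unfolding cmod_power2 by (simp add: power2_eq_square algebra_simps)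
    then have "cmod z \<le> cmod (z + 1)" by (rule power2_le_imp_le) simp
    then have "cmod z / cmod (z + 1) \<le> 1" by (simp add: divide_le_eq_1)
    then have "cmod z / cmod (z + 1) * exp (- Re z) \<le> 1 * d"
      unfolding R(2)[symmetric] using z by (intro mult_mono) auto
    then have "lam * (cmod z / cmod (z + 1) * exp (- Re z)) \<le> lam * d" using assms by (intro mult_left_mono) auto
    also have "\<dots> < d" using assms d by simp
    finally have "cmod (zmap lam z) < d" using assms by (simp add: cmod_zmap mult_ac)
    then have "zmap lam z \<in> fbasin lam" by (intro disc_subset_fbasin[OF d(2-5)])
    then show "z \<in> fbasin lam" using fbasin_iff_shift[of 1 lam z] ne by simp
  qed
qed

text \<open>Its contrapositive makes the factor in \<open>zmap_expanding\<close> at least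
  \<open>1 + \<delta>/2\<close> off the basin. The far right is covered by the half-plane, the rest
  by a tube around the compact segment [0, R].\<close>

lemma fbasin_contains_slit_neighbourhood:
  assumes "0 < lam" "lam < 1"
  obtains \<delta> where "\<delta> > 0" "\<And>z. cmod z - Re z < \<delta> * cmod (z + 1) \<Longrightarrow> z \<in> fbasin lam"
proof -
  obtain R where R: "R > 0" "\<And>z. Re z \<ge> R \<Longrightarrow> z \<in> fbasin lam"
    using right_half_plane_subset_fbasin[OF assms] by blast
  have "compact (complex_of_real ` {0..R})" 
    by (intro compact_continuous_image continuous_intros) auto
  moreover have "complex_of_real ` {0..R} \<subseteq> fbasin lam"
    using nonneg_Reals_subset_fbasin[OF assms] by auto
  ultimately obtain e where e: "e > 0" "(\<Union>x\<in>complex_of_real ` {0..R}. ball x e) \<subseteq> fbasin lam"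
    using compact_subset_open_imp_ball_epsilon_subset[OF _ open_fbasin[OF assms]] by blast
  \<comment> \<open>\<open>cmod z - Re z < \<eta>\<close> puts \<open>z\<close> within
    \<open>e\<close> of the segment: by \<open>\<eta> \<le> e\<close> if Re z < 0, otherwise by (Im
    z)^2 = (|z| - Re z)(|z| + Re z).\<close>
  define \<eta> where "\<eta> = min e (e\<^sup>2 / (4 * R + 2))"
  have "\<eta> \<le> e\<^sup>2 / (4 * R + 2)" unfolding \<eta>_def by (rule min.cobounded2)
  then have \<eta>2: "\<eta> * (4 * R + 2) \<le> e\<^sup>2" using R(1) by (simp add: pos_le_divide_eq)
  have \<eta>: "\<eta> > 0" "\<eta> \<le> e" "\<eta> * (4 * R + 2) \<le> e\<^sup>2"
    using e(1) R(1) \<eta>2 by (simp_all add: \<eta>_def)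
  \<comment> \<open>The 1/2 forces |z| < 2 R + 1 when Re z < R; the quotient then yields
    \<open>cmod z - Re z < \<eta>\<close>.\<close>
  define \<delta> where "\<delta> = min (1/2) (\<eta> / (2 * R + 2))"
  have "\<delta> \<le> \<eta> / (2 * R + 2)" unfolding \<delta>_def by (rule min.cobounded2)
  then have \<delta>2: "\<delta> * (2 * R + 2) \<le> \<eta>" using R(1) by (simp add: pos_le_divide_eq)
  have \<delta>1: "\<delta> \<le> 1/2" unfolding \<delta>_def by (rule min.cobounded1)
  have "\<delta> > 0" using \<eta>(1) R(1) by (simp add: \<delta>_def)
  note \<delta> = this \<delta>1 \<delta>2
  show ?thesis
  proof (rule that[OF \<delta>(1)])
    fix z assume z: "cmod z - Re z < \<delta> * cmod (z + 1)"
    show "z \<in> fbasin lam"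
    proof (cases "Re z \<ge> R")
      case True
      then show ?thesis by (rule R)
    next
      case False
      have q: "cmod (z + 1) \<le> cmod z + 1" using norm_triangle_ineq[of z 1] by simp
      have "\<delta> * cmod (z + 1) \<le> 1/2 * (cmod z + 1)" using \<delta> q by (intro mult_mono) auto
      then have zb: "cmod z < 2 * R + 1" using z False by simp
      have "\<delta> * cmod (z + 1) \<le> \<delta> * (2 * R + 2)" using \<delta> q zb by (intro mult_left_mono) auto
      then have h: "cmod z - Re z < \<eta>" using z \<delta> by linarith
      show ?thesis
      proof (cases "Re z \<ge> 0")
        case True
        have "(Im z)\<^sup>2 = (cmod z - Re z) * (cmod z + Re z)"
          using cmod_power2[of z] by (simp add: algebra_simps power2_eq_square)
        also have "\<dots> \<le> (cmod z - Re z) * (4 * R + 2)"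
          using zb False R complex_Re_le_cmod[of z] by (intro mult_left_mono) auto
        also have "\<dots> < \<eta> * (4 * R + 2)" using h R by (intro mult_strict_right_mono) auto
        finally have "(Im z)\<^sup>2 < e\<^sup>2" using \<eta> by linarith
        then have "\<bar>Im z\<bar> < e" using e(1) by (intro power2_less_imp_less[of _ e]) simp_all
        then have "z \<in> ball (of_real (Re z)) e" by (simp add: dist_norm cmod_eq_Im)
        moreover have "complex_of_real (Re z) \<in> complex_of_real ` {0..R}" using True False by (intro imageI) auto
        ultimately show ?thesis using e(2) by blast
      next
        case neg: False
        then have "z \<in> ball (of_real 0) e" using h \<eta> by simp
        moreover have "complex_of_real 0 \<in> complex_of_real ` {0..R}" using R by (intro imageI) auto
        ultimately show ?thesis using e(2) by blast
      qed
    qed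
  qed
qed

text \<open>Otherwise expansion along the orbit of the centre accumulates to
  \<open>(1 + \<delta>/2) ^ n\<close>, while Schwarz-Pick bounds the derivative \<open>D n\<close>.
  The weight at \<open>u n\<close> occurs in both estimates and cancels, leaving a bound independent
  of \<open>n\<close>.\<close>

lemma fbasin_meets_ball:
  assumes lam: "0 < lam" "lam < 1" and R: "R > 0"
    and alive: "\<And>z k. z \<in> ball z0 R \<Longrightarrow> (zmap lam ^^ k) z \<noteq> -1"
  shows "ball z0 R \<inter> fbasin lam \<noteq> {}"
proof
  assume disj: "ball z0 R \<inter> fbasin lam = {}"
  have out: "(zmap lam ^^ k) z \<notin> fbasin lam" if "z \<in> ball z0 R" for z k
    using disj that fbasin_iff_shift[of k lam z] alive by blast
  obtain \<delta> where \<delta>: "\<delta> > 0" "\<And>z. cmod z - Re z < \<delta> * cmod (z + 1) \<Longrightarrow> z \<in> fbasin lam"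
    using fbasin_contains_slit_neighbourhood[OF lam] by blast
  define u where "u k = (zmap lam ^^ k) z0" for k
  define D where "D n = (\<Prod>k<n. zmap' lam (u k))" for n
  have z0: "z0 \<in> ball z0 R" using R by simp
  have avoid: "(zmap lam ^^ k) z \<notin> \<real>\<^sub>\<ge>\<^sub>0" if "z \<in> ball z0 R" for z k
    using out[OF that] nonneg_Reals_subset_fbasin[OF lam] by blast
  have spos: "slit_weight (u k) > 0" for k
    using avoid[OF z0, of k] slit_weight_eq_0_iff[of "u k"] slit_weight_nonneg[of "u k"] by (simp add: u_def less_le)
  have upper: "(cmod (D n))\<^sup>2 \<le> 32 / R\<^sup>2 * slit_weight (u n)" for n
    unfolding u_def D_def
    by (rule slit_Schwarz_Pick) (use R alive avoid z0 in \<open>auto intro!: zmap_iter_holomorphic zmap_iter_derivative\<close>)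
  have step: "(1 + \<delta>/2) * slit_weight (u (Suc k)) \<le> (cmod (zmap' lam (u k)))\<^sup>2 * slit_weight (u k)" for k
  proof -
    have ne: "u k \<noteq> 0" "u k \<noteq> -1" using alive[OF z0, of k] avoid[OF z0, of k] by (auto simp: u_def)
    then have "cmod (u k + 1) > 0" by (simp add: add_eq_0_iff2)
    moreover have "cmod (u k) - Re (u k) \<ge> \<delta> * cmod (u k + 1)"
      using \<delta>(2)[of "u k"] out[OF z0, of k] by (force simp: u_def)
    ultimately have "1 + \<delta>/2 \<le> 1 + (cmod (u k) - Re (u k)) / (2 * cmod (u k + 1))"
      by (simp add: field_simps)
    then have "(1 + \<delta>/2) * slit_weight (u (Suc k)) \<le> (1 + (cmod (u k) - Re (u k)) / (2 * cmod (u k + 1))) * slit_weight (u (Suc k))"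
      by (intro mult_right_mono slit_weight_nonneg)
    also have "\<dots> \<le> (cmod (zmap' lam (u k)))\<^sup>2 * slit_weight (u k)"
      using zmap_expanding[OF ne lam(1)] by (simp add: u_def)
    finally show ?thesis .
  qed
  have lower: "(1 + \<delta>/2) ^ n * slit_weight (u n) \<le> (cmod (D n))\<^sup>2 * slit_weight (u 0)" for n
  proof (induction n)
    case (Suc n)
    have "(1 + \<delta>/2) ^ Suc n * slit_weight (u (Suc n)) = (1 + \<delta>/2) ^ n * ((1 + \<delta>/2) * slit_weight (u (Suc n)))" by simp
    also have "\<dots> \<le> (1 + \<delta>/2) ^ n * ((cmod (zmap' lam (u n)))\<^sup>2 * slit_weight (u n))"
      using \<delta> by (intro mult_left_mono step) auto
    also have "\<dots> = (cmod (zmap' lam (u n)))\<^sup>2 * ((1 + \<delta>/2) ^ n * slit_weight (u n))" by simp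
    also have "\<dots> \<le> (cmod (zmap' lam (u n)))\<^sup>2 * ((cmod (D n))\<^sup>2 * slit_weight (u 0))"
      by (intro mult_left_mono Suc.IH) auto
    also have "\<dots> = (cmod (D (Suc n)))\<^sup>2 * slit_weight (u 0)"
      by (simp add: D_def norm_mult power_mult_distrib)
    finally show ?case .
  qed (simp add: D_def)
  have bounded: "(1 + \<delta>/2) ^ n \<le> 32 / R\<^sup>2 * slit_weight (u 0)" for n
  proof -
    have "(1 + \<delta>/2) ^ n * slit_weight (u n) \<le> (32 / R\<^sup>2 * slit_weight (u n)) * slit_weight (u 0)"
      using lower[of n] mult_right_mono[OF upper[of n] slit_weight_nonneg[of "u 0"]] by linarith
    then have "(1 + \<delta>/2) ^ n * slit_weight (u n) \<le> (32 / R\<^sup>2 * slit_weight (u 0)) * slit_weight (u n)" by (simp add: mult_ac)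
    then show ?thesis using spos[of n] by (simp only: mult_le_cancel_right_pos)
  qed
  obtain n where "(1 + \<delta>/2) ^ n > 32 / R\<^sup>2 * slit_weight (u 0)"
    using real_arch_pow[of "1 + \<delta>/2"] \<delta> by auto
  with bounded[of n] show False by simp
qed

subsection \<open>The extended plane\<close>

text \<open>Iterate \<open>n\<close> itself may be -1: it is still a finite point, and infinity
  comes one step later.\<close>

lemma zeta_iter_eq:
  assumes "\<And>k. k < n \<Longrightarrow> (zmap lam ^^ k) z \<noteq> -1"
  shows "zeta_iter lam n (Some z) = Some (Some ((zmap lam ^^ n) z))"
  using assms by (induction n) (auto simp: zmap_def)

lemma zeta_iter_defined_iff:
  "(\<forall>n. zeta_iter lam n (Some z) \<noteq> None) \<longleftrightarrow> (\<forall>k. (zmap lam ^^ k) z \<noteq> -1)"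
proof
  assume def: "\<forall>n. zeta_iter lam n (Some z) \<noteq> None"
  show "\<forall>k. (zmap lam ^^ k) z \<noteq> -1"
  proof (rule ccontr)
    assume "\<not> ?thesis"
    then obtain k where k: "(zmap lam ^^ k) z = -1" "\<And>i. i < k \<Longrightarrow> (zmap lam ^^ i) z \<noteq> -1"
      using exists_least_iff[of "\<lambda>k. (zmap lam ^^ k) z = -1"] by auto
    \<comment> \<open>From -1 the next iterate is infinity, which is still defined; only the one
      after it fails.\<close>
    have "zeta_iter lam (Suc (Suc k)) (Some z) = None" using zeta_iter_eq[OF k(2)] k(1) by simp
    with def show False by blast
  qed
qed (auto simp: zeta_iter_eq)

lemma zeta_iter_None: "zeta_iter lam (Suc 0) None = None"
  by simp

section \<open>The chordal metric at finite points\<close>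

lemma cdist_Some_le: "cdist (Some z) (Some w) \<le> 2 * cmod (z - w)"
proof -
  have "1 * 1 \<le> sqrt (1 + (cmod z)\<^sup>2) * sqrt (1 + (cmod w)\<^sup>2)" by (intro mult_mono) auto
  then have "2 * cmod (z - w) / (sqrt (1 + (cmod z)\<^sup>2) * sqrt (1 + (cmod w)\<^sup>2)) \<le> 2 * cmod (z - w) / 1"
    by (intro divide_left_mono) auto
  then show ?thesis by simp
qed

lemma cdist_nonneg: "cdist p q \<ge> 0"
  by (cases p; cases q) auto

text \<open>The threshold is the chordal distance from 0 to the circle of radius \<open>d\<close>,
  and t / sqrt (1 + t^2) increases with t.\<close>

lemma cdist_zero_less_imp:
  assumes "d > 0" "cdist (Some w) (Some 0) < 2 * d / sqrt (1 + d\<^sup>2)"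
  shows "cmod w < d"
proof (rule ccontr)
  assume "\<not> ?thesis"
  then have d: "d\<^sup>2 \<le> (cmod w)\<^sup>2" using assms by (intro power_mono) auto
  have pos: "sqrt (1 + d\<^sup>2) > 0" "sqrt (1 + (cmod w)\<^sup>2) > 0" by (auto intro: add_pos_nonneg)
  have "(d * sqrt (1 + (cmod w)\<^sup>2))\<^sup>2 \<le> (cmod w * sqrt (1 + d\<^sup>2))\<^sup>2"
    using d by (simp add: power_mult_distrib algebra_simps)
  then have "d * sqrt (1 + (cmod w)\<^sup>2) \<le> cmod w * sqrt (1 + d\<^sup>2)"
    by (rule power2_le_imp_le) simp
  then have "2 * d / sqrt (1 + d\<^sup>2) \<le> 2 * cmod w / sqrt (1 + (cmod w)\<^sup>2)"
    using pos by (simp add: field_simps)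
  with assms show False by simp
qed

lemma cdist_zero_tendsto_iff:
  "((\<lambda>n. cdist (Some (w n)) (Some 0)) \<longlonglongrightarrow> 0) \<longleftrightarrow> w \<longlonglongrightarrow> 0"
proof
  assume L: "(\<lambda>n. cdist (Some (w n)) (Some 0)) \<longlonglongrightarrow> 0"
  show "w \<longlonglongrightarrow> 0"
  proof (rule tendstoI)
    fix e :: real assume e: "e > 0"
    have "2 * e / sqrt (1 + e\<^sup>2) > 0" using e by (auto intro!: divide_pos_pos add_pos_nonneg)
    then have "\<forall>\<^sub>F n in sequentially. cdist (Some (w n)) (Some 0) < 2 * e / sqrt (1 + e\<^sup>2)"
      using L by (rule order_tendstoD(2)[rotated])
    then show "\<forall>\<^sub>F n in sequentially. dist (w n) 0 < e"
      by eventually_elim (use e cdist_zero_less_imp in auto)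
  qed
next
  assume L: "w \<longlonglongrightarrow> 0"
  show "(\<lambda>n. cdist (Some (w n)) (Some 0)) \<longlonglongrightarrow> 0"
  proof (rule Lim_null_comparison)
    show "\<forall>\<^sub>F n in sequentially. norm (cdist (Some (w n)) (Some 0)) \<le> 2 * cmod (w n)"
      using cdist_Some_le[of _ 0] cdist_nonneg by (auto simp del: cdist.simps)
    show "(\<lambda>n. 2 * cmod (w n)) \<longlonglongrightarrow> 0"
      using tendsto_mult_right_zero[OF tendsto_norm_zero[OF L]] .
  qed
qed

text \<open>Passing to the limit in the explicit formula gives the distance from 0 to
  \<open>q\<close>, so no triangle inequality for \<open>cdist\<close> is involved.\<close>

lemma cdist_limit_zero:
  assumes "w \<longlonglongrightarrow> 0" "(\<lambda>n. cdist (Some (w n)) q) \<longlonglongrightarrow> 0"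
  shows "q = Some 0"
proof (cases q)
  case None
  have "(\<lambda>n. 2 / sqrt (1 + (cmod (w n))\<^sup>2)) \<longlonglongrightarrow> 2 / sqrt (1 + (cmod 0)\<^sup>2)"
    by (intro tendsto_intros assms) auto
  with assms(2) None LIMSEQ_unique show ?thesis by fastforce
next
  case (Some u)
  have u: "1 + (cmod u)\<^sup>2 > 0" by (intro add_pos_nonneg) auto
  have "(\<lambda>n. 2 * cmod (w n - u) / (sqrt (1 + (cmod (w n))\<^sup>2) * sqrt (1 + (cmod u)\<^sup>2)))
     \<longlonglongrightarrow> 2 * cmod (0 - u) / (sqrt (1 + (cmod 0)\<^sup>2) * sqrt (1 + (cmod u)\<^sup>2))"
    by (intro tendsto_intros assms) (use u in auto)
  with assms(2) Some have "2 * cmod (0 - u) / (sqrt (1 + (cmod 0)\<^sup>2) * sqrt (1 + (cmod u)\<^sup>2)) = 0"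
    using LIMSEQ_unique by fastforce
  then show ?thesis using u Some by auto
qed

lemma Some_in_basin0_iff: "Some z \<in> basin0 lam \<longleftrightarrow> z \<in> fbasin lam"
  unfolding basin0_def fbasin_def mem_Collect_eq zeta_iter_defined_iff
  using cdist_zero_tendsto_iff[of "\<lambda>n. (zmap lam ^^ n) z"]
  by (intro conj_cong refl) (simp add: zeta_iter_eq del: cdist.simps)

lemma eopen_Some_image:
  assumes "open S"
  shows "eopen (Some ` S)"
  unfolding eopen_def
proof safe
  fix w assume "w \<in> S"
  then obtain r where r: "r > 0" "ball w r \<subseteq> S" using assms open_contains_ball by blast
  define A C where "A = sqrt (1 + (cmod w)\<^sup>2)" and "C = 1 + cmod w"
  have A: "A > 0" unfolding A_def by (auto intro: add_pos_nonneg)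
  have C: "C > 0" unfolding C_def by (auto intro: add_pos_nonneg)
  \<comment> \<open>\<open>e \<le> 1 / A\<close> excludes infinity, at distance 2 / A, and gives 2 t
    < e A B <= e A (C + t) <= r + t below.\<close>
  define e where "e = min (1 / A) (r / (A * C))"
  have e: "e > 0" using A C r by (simp add: e_def)
  have "e \<le> 1 / A" unfolding e_def by (rule min.cobounded1)
  then have eA: "e * A \<le> 1" using A by (simp add: pos_le_divide_eq)
  have "e \<le> r / (A * C)" unfolding e_def by (rule min.cobounded2)
  then have eAC: "e * (A * C) \<le> r" using A C by (simp add: pos_le_divide_eq)
  have "{q. cdist (Some w) q < e} \<subseteq> Some ` S"
  proof safe
    fix q assume q: "cdist (Some w) q < e"
    show "q \<in> Some ` S"
    proof (cases q)
      case None
      with q have "2 / A < e" by (simp add: A_def)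
      then have "2 < e * A" using A by (simp add: pos_divide_less_eq)
      with eA show ?thesis by simp
    next
      case (Some v)
      define t B where "t = cmod (w - v)" and "B = sqrt (1 + (cmod v)\<^sup>2)"
      have B: "B > 0" unfolding B_def by (auto intro: add_pos_nonneg)
      have "B \<le> 1 + cmod v" unfolding B_def by (rule real_le_lsqrt) (auto simp: power2_eq_square algebra_simps)
      also have "\<dots> \<le> C + t" unfolding C_def t_def using norm_triangle_ineq2[of v w] by (simp add: norm_minus_commute)
      finally have BC: "B \<le> C + t" .
      have "2 * t < e * (A * B)" using q Some A B by (simp add: t_def A_def B_def pos_divide_less_eq)
      also have "\<dots> = (e * A) * B" by simp
      also have "\<dots> \<le> (e * A) * (C + t)" using BC e A by (intro mult_left_mono) auto
      also have "\<dots> = e * (A * C) + (e * A) * t" by (simp add: algebra_simps)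
      also have "\<dots> \<le> r + 1 * t" using eA eAC by (intro add_mono mult_right_mono) (auto simp: t_def)
      finally have "t < r" by simp
      then have "v \<in> ball w r" by (simp add: t_def dist_norm)
      with r Some show ?thesis by blast
    qed
  qed
  with e show "\<exists>e>0. {q. cdist (Some w) q < e} \<subseteq> Some ` S" by blast
qed

section \<open>Normality and the basin\<close>

text \<open>The index sequence \<open>s\<close> is arbitrary. Either a value recurs infinitely often
  and gives a constant subsequence, or \<open>s\<close> tends to infinity and the whole sequence
  converges to 0.\<close>

lemma normal_family_if_unif_null:
  assumes "\<And>n q. q \<in> U \<Longrightarrow> F n q = Some (G n q)"
    and "\<And>e. e > 0 \<Longrightarrow> \<exists>N. \<forall>n\<ge>N. \<forall>q\<in>U. cmod (G n q) < e"
  shows "normal_family U F"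
  unfolding normal_family_def
proof
  fix s :: "nat \<Rightarrow> nat"
  show "\<exists>r h. strict_mono r \<and> loc_unif_conv U (\<lambda>j. F (s (r j))) h"
  proof (cases "\<exists>m. infinite {j. s j = m}")
    case True
    then obtain m where m: "infinite {j. s j = m}" by blast
    define r where "r = enumerate {j. s j = m}"
    have sr: "s (r j) = m" for j using enumerate_in_set[OF m, of j] by (simp add: r_def)
    have "cdist (F m q) (F m q) = 0" for q by (cases "F m q") auto
    then have "loc_unif_conv U (\<lambda>j. F (s (r j))) (F m)"
      by (auto simp: loc_unif_conv_def sr intro!: exI[of _ 1])
    moreover have "strict_mono r" unfolding r_def using m by (rule strict_mono_enumerate)
    ultimately show ?thesis by blast
  next
    case False
    have ev: "\<exists>J. \<forall>j\<ge>J. s j \<ge> N" for N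
    proof -
      have "{j. s j < N} = (\<Union>m<N. {j. s j = m})" by auto
      then have "finite {j. s j < N}" using False by auto
      then obtain J where "\<forall>j\<in>{j. s j < N}. j < J" using finite_nat_set_iff_bounded by blast
      then show ?thesis by (metis leD linorder_le_less_linear mem_Collect_eq)
    qed
    have "loc_unif_conv U (\<lambda>j. F (s (id j))) (\<lambda>q. Some 0)"
      unfolding loc_unif_conv_def
    proof (intro ballI exI[of _ "1::real"] conjI allI impI)
      fix e :: real assume e: "e > 0"
      then obtain N where N: "\<forall>n\<ge>N. \<forall>q\<in>U. cmod (G n q) < e/2" using assms(2)[of "e/2"] by auto
      obtain J where J: "\<forall>j\<ge>J. s j \<ge> N" using ev by blast
      have "cdist (F (s (id j)) q) (Some 0) < e" if "j \<ge> J" "q \<in> U" for j q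
        using cdist_Some_le[of "G (s j) q" 0] N J that assms(1)[OF that(2)] by (force simp del: cdist.simps)
      then show "\<exists>N. \<forall>j\<ge>N. \<forall>q\<in>U. cdist p q < 1 \<longrightarrow> cdist (F (s (id j)) q) (Some 0) < e" for p by blast
    qed simp
    then show ?thesis using strict_mono_id by blast
  qed
qed

text \<open>All nearby orbits enter the contracting disc within the same number of steps, so the
  iterates tend to 0 uniformly on a ball.\<close>

lemma fbasin_subset_fatou:
  assumes "0 < lam" "lam < 1" "z \<in> fbasin lam"
  shows "Some z \<in> fatou_set lam"
proof -
  obtain d \<kappa> where d: "0 < d" "d < 1" "0 < \<kappa>" "\<kappa> < 1" "\<And>z. cmod z < d \<Longrightarrow> cmod (zmap lam z) \<le> \<kappa> * cmod z"
    using attracting_disc[OF assms(1,2)] by blast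
  obtain n r where r: "r > 0" "\<And>w k. w \<in> ball z r \<Longrightarrow> k < n \<Longrightarrow> (zmap lam ^^ k) w \<noteq> -1"
      "\<And>w. w \<in> ball z r \<Longrightarrow> cmod ((zmap lam ^^ n) w) < d"
    by (rule fbasin_local[OF assms(3) d(1)]) blast
  have "w \<in> fbasin lam" if "w \<in> ball z r" for w
    using fbasin_iff_shift[of n lam w] r that disc_subset_fbasin[OF d(2-5)] by blast
  then have alive: "(zmap lam ^^ k) w \<noteq> -1" if "w \<in> ball z r" for w k
    using that by (auto simp: fbasin_def)
  have small: "cmod ((zmap lam ^^ m) w) \<le> \<kappa> ^ (m - n) * d" if "w \<in> ball z r" "m \<ge> n" for w m
  proof -
    have "cmod ((zmap lam ^^ (m - n)) ((zmap lam ^^ n) w)) \<le> \<kappa> ^ (m - n) * cmod ((zmap lam ^^ n) w)"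
      by (rule funpow_contraction[of _ d]) (use d r(3)[OF that(1)] in auto)
    also have "\<dots> \<le> \<kappa> ^ (m - n) * d" using d r(3)[OF that(1)] by (intro mult_left_mono) auto
    also have "(zmap lam ^^ (m - n)) ((zmap lam ^^ n) w) = (zmap lam ^^ m) w"
      using that(2) by (metis comp_apply funpow_add le_add_diff_inverse2)
    finally show ?thesis .
  qed
  have "normal_family (Some ` ball z r) (\<lambda>n q. the (zeta_iter lam n q))"
  proof (rule normal_family_if_unif_null)
    show "the (zeta_iter lam m q) = Some ((zmap lam ^^ m) (the q))" if "q \<in> Some ` ball z r" for m q
      using that alive by (auto simp: zeta_iter_eq)
    show "\<exists>N. \<forall>m\<ge>N. \<forall>q\<in>Some ` ball z r. cmod ((zmap lam ^^ m) (the q)) < e" if "e > 0" for e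
    proof -
      obtain K where K: "\<kappa> ^ K < e" using real_arch_pow_inv[OF \<open>e > 0\<close> d(4)] by blast
      have "cmod ((zmap lam ^^ m) w) < e" if "m \<ge> n + K" "w \<in> ball z r" for m w
      proof -
        have "cmod ((zmap lam ^^ m) w) \<le> \<kappa> ^ (m - n) * d" using small that by simp
        also have "\<dots> \<le> \<kappa> ^ K * 1" using d that by (intro mult_mono power_decreasing) auto
        finally show ?thesis using K by simp
      qed
      then show ?thesis by (intro exI[of _ "n + K"]) auto
    qed
  qed
  moreover have "zeta_iter lam m q \<noteq> None" if "q \<in> Some ` ball z r" for m q
    using that alive by (auto simp: zeta_iter_eq)
  ultimately show ?thesis unfolding fatou_set_def mem_Collect_eq using r(1) eopen_Some_image[OF open_ball]
    by (intro exI[of _ "Some ` ball z r"]) auto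
qed

lemma fatou_subset_fbasin:
  assumes "0 < lam" "lam < 1" "Some z0 \<in> fatou_set lam"
  shows "z0 \<in> fbasin lam"
proof -
  obtain U where U: "eopen U" "Some z0 \<in> U" "\<And>n q. q \<in> U \<Longrightarrow> zeta_iter lam n q \<noteq> None"
      and nf: "normal_family U (\<lambda>n q. the (zeta_iter lam n q))"
    using assms(3) unfolding fatou_set_def by blast
  obtain e where e: "e > 0" "{q. cdist (Some z0) q < e} \<subseteq> U" using U(1,2) unfolding eopen_def by blast
  \<comment> \<open>Radius \<open>e/2\<close> because \<open>cdist\<close> is at most twice the
    Euclidean distance.\<close>
  define V where "V = ball z0 (e/2)"
  have VU: "Some w \<in> U" if "w \<in> V" for w
    using that cdist_Some_le[of z0 w] e(2) by (force simp: V_def dist_norm simp del: cdist.simps)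
  have alive: "(zmap lam ^^ k) w \<noteq> -1" if "w \<in> V" for w k
    using U(3)[OF VU[OF that]] zeta_iter_defined_iff[of lam w] by blast
  have it: "the (zeta_iter lam n (Some w)) = Some ((zmap lam ^^ n) w)" if "w \<in> V" for w n
    using alive[OF that] by (simp add: zeta_iter_eq)
  obtain d \<kappa> where d: "0 < d" "d < 1" "0 < \<kappa>" "\<kappa> < 1" "\<And>z. cmod z < d \<Longrightarrow> cmod (zmap lam z) \<le> \<kappa> * cmod z"
    using attracting_disc[OF assms(1,2)] by blast
  obtain r h where r: "strict_mono r" and lu: "loc_unif_conv U (\<lambda>j q. the (zeta_iter lam (r j) q)) h"
    using nf[unfolded normal_family_def, THEN spec, of "\<lambda>n. n"] by blast
  \<comment> \<open>Relative closedness of the basin: one late iterate is below d/2 at the basin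
    points near \<open>z\<close>, yet above d/2 at every point close to \<open>z\<close>.\<close>
  have "\<exists>\<rho>>0. ball z \<rho> \<subseteq> V - fbasin lam" if z: "z \<in> V" "z \<notin> fbasin lam" for z
  proof -
    obtain \<rho> where \<rho>: "\<rho> > 0" "\<forall>\<epsilon>>0. \<exists>N. \<forall>j\<ge>N. \<forall>q\<in>U. cdist (Some z) q < \<rho> \<longrightarrow>
        cdist (the (zeta_iter lam (r j) q)) (h q) < \<epsilon>"
      using lu[unfolded loc_unif_conv_def, THEN bspec, OF VU[OF z(1)]] by blast
    have near: "cdist (Some z) (Some w) < \<rho>" if "w \<in> ball z (\<rho>/2)" for w
      using that cdist_Some_le[of z w] by (simp add: dist_norm del: cdist.simps)
    have unif: "\<exists>N. \<forall>j\<ge>N. \<forall>w\<in>V \<inter> ball z (\<rho>/2). cdist (Some ((zmap lam ^^ r j) w)) (h (Some w)) < \<epsilon>"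
      if eps: "\<epsilon> > 0" for \<epsilon>
    proof -
      obtain N where N: "\<forall>j\<ge>N. \<forall>q\<in>U. cdist (Some z) q < \<rho> \<longrightarrow> cdist (the (zeta_iter lam (r j) q)) (h q) < \<epsilon>"
        using \<rho>(2)[rule_format, OF eps] by blast
      have "cdist (Some ((zmap lam ^^ r j) w)) (h (Some w)) < \<epsilon>" if "j \<ge> N" "w \<in> V" "w \<in> ball z (\<rho>/2)" for j w
        using N that VU[OF that(2)] near[OF that(3)] it[OF that(2), of "r j"] by metis
      then show ?thesis by blast
    qed
    have h0: "h (Some w) = Some 0" if w: "w \<in> V" "w \<in> ball z (\<rho>/2)" "w \<in> fbasin lam" for w
    proof (rule cdist_limit_zero)
      show "(\<lambda>j. (zmap lam ^^ r j) w) \<longlonglongrightarrow> 0"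
        using w(3) LIMSEQ_subseq_LIMSEQ[OF _ r, of "\<lambda>n. (zmap lam ^^ n) w" 0] by (simp add: fbasin_def o_def)
      show "(\<lambda>j. cdist (Some ((zmap lam ^^ r j) w)) (h (Some w))) \<longlonglongrightarrow> 0"
      proof (rule LIMSEQ_I)
        fix \<epsilon> :: real assume "\<epsilon> > 0"
        from unif[OF this] obtain N
          where "\<forall>j\<ge>N. \<forall>w\<in>V \<inter> ball z (\<rho>/2). cdist (Some ((zmap lam ^^ r j) w)) (h (Some w)) < \<epsilon>" ..
        then have "\<forall>j\<ge>N. cdist (Some ((zmap lam ^^ r j) w)) (h (Some w)) < \<epsilon>" using w(1,2) by blast
        then show "\<exists>N. \<forall>j\<ge>N. norm (cdist (Some ((zmap lam ^^ r j) w)) (h (Some w)) - 0) < \<epsilon>"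
          by (auto simp: cdist_nonneg simp del: cdist.simps)
      qed
    qed
    have "2 * (d/2) / sqrt (1 + (d/2)\<^sup>2) > 0" using d(1) by (auto intro!: divide_pos_pos add_pos_nonneg)
    from unif[OF this] obtain j where "\<forall>i\<ge>j. \<forall>w\<in>V \<inter> ball z (\<rho>/2).
        cdist (Some ((zmap lam ^^ r i) w)) (h (Some w)) < 2 * (d/2) / sqrt (1 + (d/2)\<^sup>2)" ..
    then have j: "\<And>w. w \<in> V \<Longrightarrow> w \<in> ball z (\<rho>/2) \<Longrightarrow>
            cdist (Some ((zmap lam ^^ r j) w)) (h (Some w)) < 2 * (d/2) / sqrt (1 + (d/2)\<^sup>2)"
      by blast
    have small: "cmod ((zmap lam ^^ r j) w) < d/2" if "w \<in> V" "w \<in> ball z (\<rho>/2)" "w \<in> fbasin lam" for w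
      using j[OF that(1,2)] h0[OF that] d(1) by (intro cdist_zero_less_imp) (auto simp del: cdist.simps)
    \<comment> \<open>The orbit of a point outside the basin never enters the attracting disc, so
      its modulus stays at least \<open>d\<close>.\<close>
    have "(zmap lam ^^ r j) z \<notin> fbasin lam"
      using z fbasin_iff_shift[of "r j" lam z] alive by blast
    then have big: "cmod ((zmap lam ^^ r j) z) \<ge> d"
      using disc_subset_fbasin[OF d(2-5)] by (meson not_le)
    have "isCont (\<lambda>w. cmod ((zmap lam ^^ r j) w)) z"
      using alive[OF z(1)] by (intro continuous_norm isCont_zmap_iter)
    then have "((\<lambda>w. cmod ((zmap lam ^^ r j) w)) \<longlongrightarrow> cmod ((zmap lam ^^ r j) z)) (nhds z)"
      using tendsto_at_iff_tendsto_nhds[of "\<lambda>w. cmod ((zmap lam ^^ r j) w)" z] by (simp add: isCont_def)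
    then have "\<forall>\<^sub>F w in nhds z. cmod ((zmap lam ^^ r j) w) > d/2"
      using big d(1) by (intro order_tendstoD(1)) auto
    moreover have "\<forall>\<^sub>F w in nhds z. w \<in> V \<inter> ball z (\<rho>/2)"
      using z(1) \<rho>(1) by (intro eventually_nhds_in_open) (auto simp: V_def)
    ultimately have "\<forall>\<^sub>F w in nhds z. w \<in> V - fbasin lam"
      by eventually_elim (use small in force)
    then show ?thesis unfolding eventually_nhds_metric by (auto simp: subset_eq dist_commute)
  qed
  then have opn: "open (V - fbasin lam)" unfolding open_contains_ball by blast
  have "V \<inter> fbasin lam \<noteq> {}"
    unfolding V_def by (rule fbasin_meets_ball) (use assms e(1) alive in \<open>auto simp: V_def\<close>)
  \<comment> \<open>The ball \<open>V\<close> is connected and is split into two open parts, the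
    first of them nonempty.\<close>
  then have "V - fbasin lam = {}"
    using connectedD[of V "fbasin lam" "V - fbasin lam"] opn open_fbasin[OF assms(1,2)]
    by (auto simp: V_def)
  then show ?thesis using e(1) by (auto simp: V_def)
qed

theorem theorem5:
  fixes lam :: real
  assumes "0 < lam" and "lam < 1"
  shows "julia_set lam = UNIV - basin0 lam"
proof -
  have "p \<in> fatou_set lam \<longleftrightarrow> p \<in> basin0 lam" for p
  proof (cases p)
    case None
    \<comment> \<open>At infinity the first iterate is already undefined, which excludes it from
      both sets.\<close>
    have "None \<notin> fatou_set lam" "None \<notin> basin0 lam"
      unfolding fatou_set_def basin0_def using zeta_iter_None[of lam] by blast+
    with None show ?thesis by simp
  next
    case (Some z)
    then show ?thesis
      using fbasin_subset_fatou fatou_subset_fbasin assms by (auto simp: Some_in_basin0_iff)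
  qed
  then show ?thesis by (auto simp: julia_set_def)
qed

end
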